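(* Let $k$ be a field, let $e\ge 5$ be an integer, $a=e+1$, and let $b,d$ be positive integers with $b>a+(e-3)d$, $\gcd(a,d)=1$ and $d\nmid (b-a)$. Assume that $M=\{a,a+d,a+2d,\ldots,a+(e-3)d,b,b+d\}$ is a minimal generating set of the numerical semigroup $\Gamma_e(M)$ generated by $M$, and let $\mathfrak{p}(M)\subset k[x_0,\ldots,x_{e-1}]$ be the defining ideal of $\Gamma_e(M)$. Then $$\mathcal{G}=\bigcup_{i=1}^{e-1}\{\, f(\epsilon_j,i)\mid \epsilon_j\in\underline{\mathcal{B}}'_i,\ i\le j\le e-1\,\}$$ is a minimal generating set for $\mathfrak{p}(M)$.
   Context: Write $n_i=a+id$ for $0\le i\le e-3$, $n_{e-2}=b$, $n_{e-1}=b+d$. The ideal $\mathfrak{p}(M)$ is the kernel of the $k$-algebra homomorphism $k[x_0,\ldots,x_{e-1}]\to k[t]$, $x_i\mapsto t^{n_i}$. Let $\epsilon_0,\ldots,\epsilon_{e-1}$ be the standard basis of $(\mathbb{Z}_{\ge 0})^{e}$ ($\epsilon_0=(1,0,\ldots,0)$, etc.). For $\alpha=\sum_{i=0}^{e-1}\alpha_i\epsilon_i\in(\mathbb{Z}_{\ge0})^e$ put $\deg(\alpha)=\sum_{i=0}^{e-1}\alpha_in_i$ and $x^\alpha=\prod_{i=0}^{e-1}x_i^{\alpha_i}$. For $s\in\Gamma_e(M)$ let $\tau(s)$ be the unique maximal element, with respect to the lexicographic order, among the $\alpha\in(\mathbb{Z}_{\ge0})^e$ with $\deg(\alpha)=s$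 (lexicographic order: $\alpha>\beta$ if the first nonzero entry of $\alpha-\beta$ is positive). Define $\underline{\mathcal{B}}=\{\tau(s)\mid s\in\Gamma_e(M)\}$ and, for $1\le i\le e-1$, $$\underline{\mathcal{B}}_i=\{\tau\in\underline{\mathcal{B}}\mid \tau+\epsilon_i\notin\underline{\mathcal{B}}\},\qquad \underline{\mathcal{B}}'_i=\underline{\mathcal{B}}_i\setminus\bigcup_{j=1}^{e-1}(\underline{\mathcal{B}}_i+\epsilon_j).$$ For $\alpha\in(\mathbb{Z}_{\ge0})^e$ and $0\le i\le e-1$ put $f(\alpha,i)=x_ix^\alpha-x^{\tau(s)}$, where $s=\deg(\alpha+\epsilon_i)$. *)

theory Defs
  imports "HOL-Library.Poly_Mapping" "HOL-Computational_Algebra.Polynomial"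
    "HOL-Algebra.RingHom"
begin

section \<open>Semigroups generated by sets of natural numbers\<close>

inductive_set semigroup_span :: "nat set \<Rightarrow> nat set" for M :: "nat set" where
  zero: "0 \<in> semigroup_span M"
| add: "m \<in> M \<Longrightarrow> s \<in> semigroup_span M \<Longrightarrow> m + s \<in> semigroup_span M"

definition minimal_semigroup_generating_set :: "nat set \<Rightarrow> nat set \<Rightarrow> bool" where
  "minimal_semigroup_generating_set M S \<longleftrightarrow>
     semigroup_span M = S \<and> (\<forall>N. N \<subset> M \<longrightarrow> semigroup_span N \<noteq> S)"


section \<open>Exponent vectors\<close>

text \<open>An element of \<open>\<nat>\<^sup>e\<close> is a finitely supported function on \<^typ>\<open>nat\<close>
  with support in \<open>{..<e}\<close>.\<close>

definition exponents :: "nat \<Rightarrow> (nat \<Rightarrow>\<^sub>0 nat) set" where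
  "exponents e = {\<alpha>. Poly_Mapping.keys \<alpha> \<subseteq> {..<e}}"

definition unit_vec :: "nat \<Rightarrow> (nat \<Rightarrow>\<^sub>0 nat)" where
  "unit_vec i = Poly_Mapping.single i 1"

definition wdeg :: "nat \<Rightarrow> (nat \<Rightarrow> nat) \<Rightarrow> (nat \<Rightarrow>\<^sub>0 nat) \<Rightarrow> nat" where
  "wdeg e n \<alpha> = (\<Sum>i<e. Poly_Mapping.lookup \<alpha> i * n i)"

text \<open>The library order on \<^typ>\<open>nat \<Rightarrow>\<^sub>0 nat\<close> is the lexicographic
  order in which the entry of smallest index counts first.\<close>

lemma less_exponent_iff_lex:
  fixes \<alpha> \<beta> :: "nat \<Rightarrow>\<^sub>0 nat"
  shows "\<alpha> < \<beta> \<longleftrightarrow>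
    (\<exists>i. Poly_Mapping.lookup \<alpha> i < Poly_Mapping.lookup \<beta> i \<and>
         (\<forall>j<i. Poly_Mapping.lookup \<alpha> j = Poly_Mapping.lookup \<beta> j))"
  by transfer (simp add: less_fun_def)

text \<open>\<^const>\<open>Max\<close> is taken with respect to that order, over a set that is finite if the
  weights are positive and nonempty if \<open>s\<close> lies in the semigroup.\<close>

definition tau :: "nat \<Rightarrow> (nat \<Rightarrow> nat) \<Rightarrow> nat \<Rightarrow> (nat \<Rightarrow>\<^sub>0 nat)" where
  "tau e n s = Max {\<alpha> \<in> exponents e. wdeg e n \<alpha> = s}"

lemma finite_wdeg_eq:
  assumes "\<And>i. i < e \<Longrightarrow> 0 < n i"
  shows "finite {\<alpha> \<in> exponents e. wdeg e n \<alpha> = s}"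
proof -
  let ?A = "{\<alpha> \<in> exponents e. wdeg e n \<alpha> = s}"
  let ?F = "{f. \<forall>x. (x \<in> {..<e} \<longrightarrow> f x \<in> {..s}) \<and> (x \<notin> {..<e} \<longrightarrow> f x = (0::nat))}"
  have "Poly_Mapping.lookup ` ?A \<subseteq> ?F"
  proof clarify
    fix \<alpha> x assume a: "\<alpha> \<in> exponents e" and s: "s = wdeg e n \<alpha>"
    show "(x \<in> {..<e} \<longrightarrow> Poly_Mapping.lookup \<alpha> x \<in> {..wdeg e n \<alpha>}) \<and>
          (x \<notin> {..<e} \<longrightarrow> Poly_Mapping.lookup \<alpha> x = 0)"
    proof (intro conjI impI)
      assume x: "x \<in> {..<e}"
      then have "Poly_Mapping.lookup \<alpha> x \<le> Poly_Mapping.lookup \<alpha> x * n x"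
        using assms[of x] by simp
      also have "\<dots> \<le> wdeg e n \<alpha>"
        unfolding wdeg_def using x by (intro member_le_sum) auto
      finally show "Poly_Mapping.lookup \<alpha> x \<in> {..wdeg e n \<alpha>}" by simp
    next
      assume "x \<notin> {..<e}"
      then show "Poly_Mapping.lookup \<alpha> x = 0"
        using a unfolding exponents_def by (meson in_keys_iff mem_Collect_eq subsetD)
    qed
  qed
  moreover have "finite ?F" by (rule finite_set_of_finite_funs) auto
  ultimately have "finite (Poly_Mapping.lookup ` ?A)" by (rule finite_subset)
  then show ?thesis
    by (rule finite_imageD) (simp add: inj_on_def poly_mapping.lookup_inject)
qed

definition Bset :: "nat \<Rightarrow> (nat \<Rightarrow> nat) \<Rightarrow> (nat \<Rightarrow>\<^sub>0 nat) set" where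
  "Bset e n = tau e n ` semigroup_span (n ` {..<e})"

definition Bset_i :: "nat \<Rightarrow> (nat \<Rightarrow> nat) \<Rightarrow> nat \<Rightarrow> (nat \<Rightarrow>\<^sub>0 nat) set" where
  "Bset_i e n i = {\<alpha> \<in> Bset e n. \<alpha> + unit_vec i \<notin> Bset e n}"

definition Bset_i' :: "nat \<Rightarrow> (nat \<Rightarrow> nat) \<Rightarrow> nat \<Rightarrow> (nat \<Rightarrow>\<^sub>0 nat) set" where
  "Bset_i' e n i =
     Bset_i e n i - (\<Union>j\<in>{1..e - 1}. (\<lambda>\<alpha>. \<alpha> + unit_vec j) ` Bset_i e n i)"


section \<open>The polynomial ring in \<open>e\<close> variables\<close>

text \<open>\<^typ>\<open>(nat \<Rightarrow>\<^sub>0 nat) \<Rightarrow>\<^sub>0 'k\<close> is the ring of polynomials in countably many variables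
  \<open>x\<^sub>0, x\<^sub>1, \<dots>\<close>; the polynomials in \<open>x\<^sub>0, \<dots>, x\<^bsub>e-1\<^esub>\<close> form a subring.\<close>

definition xpow :: "(nat \<Rightarrow>\<^sub>0 nat) \<Rightarrow> ((nat \<Rightarrow>\<^sub>0 nat) \<Rightarrow>\<^sub>0 'k::field)" where
  "xpow \<alpha> = Poly_Mapping.single \<alpha> 1"

definition var :: "nat \<Rightarrow> ((nat \<Rightarrow>\<^sub>0 nat) \<Rightarrow>\<^sub>0 'k::field)" where
  "var i = xpow (unit_vec i)"

definition mpoly_ring :: "nat \<Rightarrow> ((nat \<Rightarrow>\<^sub>0 nat) \<Rightarrow>\<^sub>0 'k::field) ring" where
  "mpoly_ring e =
     \<lparr>carrier = {p. Poly_Mapping.keys p \<subseteq> exponents e},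
      monoid.mult = (*), one = 1, ring.zero = 0, add = (+)\<rparr>"

definition upoly_ring :: "'k::field poly ring" where
  "upoly_ring = \<lparr>carrier = UNIV, monoid.mult = (*), one = 1, ring.zero = 0, add = (+)\<rparr>"

text \<open>The \<open>k\<close>-algebra homomorphism \<open>x\<^sub>i \<mapsto> t ^ n i\<close>.\<close>

definition param_hom ::
    "nat \<Rightarrow> (nat \<Rightarrow> nat) \<Rightarrow> ((nat \<Rightarrow>\<^sub>0 nat) \<Rightarrow>\<^sub>0 'k::field) \<Rightarrow> 'k poly" where
  "param_hom e n p =
     (\<Sum>\<alpha>\<in>Poly_Mapping.keys p.
        Polynomial.smult (Poly_Mapping.lookup p \<alpha>)
          (\<Prod>i<e. Polynomial.monom 1 (n i) ^ Poly_Mapping.lookup \<alpha> i))"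

definition defining_ideal ::
    "nat \<Rightarrow> (nat \<Rightarrow> nat) \<Rightarrow> ((nat \<Rightarrow>\<^sub>0 nat) \<Rightarrow>\<^sub>0 'k::field) set" where
  "defining_ideal e n = a_kernel (mpoly_ring e) upoly_ring (param_hom e n)"

text \<open>Minimality is with respect to inclusion.\<close>

definition minimal_ideal_generating_set ::
    "('a, 'm) ring_scheme \<Rightarrow> 'a set \<Rightarrow> 'a set \<Rightarrow> bool" where
  "minimal_ideal_generating_set R G I \<longleftrightarrow>
     G \<subseteq> carrier R \<and> Idl\<^bsub>R\<^esub> G = I \<and> (\<forall>H. H \<subset> G \<longrightarrow> Idl\<^bsub>R\<^esub> H \<noteq> I)"

definition fpoly ::
    "nat \<Rightarrow> (nat \<Rightarrow> nat) \<Rightarrow> (nat \<Rightarrow>\<^sub>0 nat) \<Rightarrow> nat \<Rightarrow> ((nat \<Rightarrow>\<^sub>0 nat) \<Rightarrow>\<^sub>0 'k::field)" where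
  "fpoly e n \<alpha> i = var i * xpow \<alpha> - xpow (tau e n (wdeg e n (\<alpha> + unit_vec i)))"

lemma exponents_zero: "0 \<in> exponents e"
  by (simp add: exponents_def)

lemma exponents_add: "\<alpha> \<in> exponents e \<Longrightarrow> \<beta> \<in> exponents e \<Longrightarrow> \<alpha> + \<beta> \<in> exponents e"
  using Poly_Mapping.keys_add[of \<alpha> \<beta>] by (auto simp: exponents_def)

lemma cring_mpoly_ring: "cring (mpoly_ring e :: ((nat \<Rightarrow>\<^sub>0 nat) \<Rightarrow>\<^sub>0 'k::field) ring)"
proof (rule cringI)
  let ?R = "mpoly_ring e :: ((nat \<Rightarrow>\<^sub>0 nat) \<Rightarrow>\<^sub>0 'k) ring"
  have add: "p + q \<in> carrier ?R" if "p \<in> carrier ?R" "q \<in> carrier ?R" for p q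
    using that Poly_Mapping.keys_add[of p q] by (auto simp: mpoly_ring_def)
  have mult: "p * q \<in> carrier ?R" if "p \<in> carrier ?R" "q \<in> carrier ?R" for p q
  proof -
    have "Poly_Mapping.keys (p * q) \<subseteq> exponents e"
    proof
      fix \<gamma> assume "\<gamma> \<in> Poly_Mapping.keys (p * q)"
      then obtain \<alpha> \<beta> where "\<gamma> = \<alpha> + \<beta>" "\<alpha> \<in> Poly_Mapping.keys p" "\<beta> \<in> Poly_Mapping.keys q"
        using Poly_Mapping.keys_mult[of p q] by auto
      with that show "\<gamma> \<in> exponents e"
        by (auto simp: mpoly_ring_def intro: exponents_add)
    qed
    then show ?thesis by (simp add: mpoly_ring_def)
  qed
  show "abelian_group ?R"
  proof (rule abelian_groupI)
    fix p assume "p \<in> carrier ?R"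
    then have "- p \<in> carrier ?R" by (simp add: mpoly_ring_def)
    then show "\<exists>q\<in>carrier ?R. q \<oplus>\<^bsub>?R\<^esub> p = \<zero>\<^bsub>?R\<^esub>"
      by (intro bexI[of _ "- p"]) (simp_all add: mpoly_ring_def)
  qed (use add in \<open>auto simp: mpoly_ring_def algebra_simps\<close>)
  show "comm_monoid ?R"
    by (rule comm_monoidI)
      (use mult in \<open>auto simp: mpoly_ring_def algebra_simps exponents_zero\<close>)
qed (auto simp: mpoly_ring_def algebra_simps)

lemma cring_upoly_ring: "cring (upoly_ring :: 'k::field poly ring)"
proof (rule cringI)
  show "abelian_group (upoly_ring :: 'k poly ring)"
  proof (rule abelian_groupI)
    fix p :: "'k poly"
    show "\<exists>q\<in>carrier upoly_ring. q \<oplus>\<^bsub>upoly_ring\<^esub> p = \<zero>\<^bsub>upoly_ring\<^esub>"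
      by (intro bexI[of _ "- p"]) (simp_all add: upoly_ring_def)
  qed (auto simp: upoly_ring_def algebra_simps)
  show "comm_monoid (upoly_ring :: 'k poly ring)"
    by (rule comm_monoidI) (auto simp: upoly_ring_def algebra_simps)
qed (auto simp: upoly_ring_def algebra_simps)

lemma param_hom_superset:
  assumes "finite S" "Poly_Mapping.keys p \<subseteq> S"
  shows "param_hom e n p =
    (\<Sum>\<alpha>\<in>S. Polynomial.smult (Poly_Mapping.lookup p \<alpha>)
          (\<Prod>i<e. Polynomial.monom 1 (n i) ^ Poly_Mapping.lookup \<alpha> i))"
  unfolding param_hom_def using assms
  by (intro sum.mono_neutral_left) (auto simp: in_keys_iff)

lemma param_hom_add: "param_hom e n (p + q) = param_hom e n p + param_hom e n q"
proof -
  let ?S = "Poly_Mapping.keys p \<union> Poly_Mapping.keys q"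
  show ?thesis
    using Poly_Mapping.keys_add[of p q]
    by (simp add: param_hom_superset[of ?S] lookup_add smult_add_left sum.distrib)
qed

lemma param_hom_single:
  "param_hom e n (Poly_Mapping.single \<alpha> c) =
     Polynomial.smult c (\<Prod>i<e. Polynomial.monom 1 (n i) ^ Poly_Mapping.lookup \<alpha> i)"
  by (subst param_hom_superset[of "{\<alpha>}"]) auto

lemma param_hom_sum: "param_hom e n (\<Sum>a\<in>A. g a) = (\<Sum>a\<in>A. param_hom e n (g a))"
  by (induction A rule: infinite_finite_induct) (auto simp: param_hom_add param_hom_def[of _ _ 0])

lemma poly_mapping_sum_single:
  "p = (\<Sum>\<alpha>\<in>Poly_Mapping.keys p. Poly_Mapping.single \<alpha> (Poly_Mapping.lookup p \<alpha>))"
  by (rule poly_mapping_eqI)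
    (auto simp: lookup_sum lookup_single when_def in_keys_iff)

lemma param_hom_mult: "param_hom e n (p * q) = param_hom e n p * param_hom e n q"
proof -
  have "param_hom e n (p * q) = param_hom e n
     ((\<Sum>\<alpha>\<in>Poly_Mapping.keys p. Poly_Mapping.single \<alpha> (Poly_Mapping.lookup p \<alpha>)) *
      (\<Sum>\<beta>\<in>Poly_Mapping.keys q. Poly_Mapping.single \<beta> (Poly_Mapping.lookup q \<beta>)))"
    using poly_mapping_sum_single[of p] poly_mapping_sum_single[of q] by simp
  also have "\<dots> = param_hom e n p * param_hom e n q"
    by (simp add: sum_product param_hom_sum mult_single param_hom_single lookup_add power_add
        prod.distrib param_hom_def[of _ _ p] param_hom_def[of _ _ q] mult.commute)
  finally show ?thesis .
qed

lemma ring_hom_param_hom: "param_hom e n \<in> ring_hom (mpoly_ring e) upoly_ring"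
proof (rule ring_hom_memI)
  show "param_hom e n \<one>\<^bsub>mpoly_ring e\<^esub> = \<one>\<^bsub>upoly_ring\<^esub>"
    using param_hom_single[of e n 0 1] by (simp add: mpoly_ring_def upoly_ring_def flip: one_pCons)
qed (auto simp: mpoly_ring_def upoly_ring_def param_hom_add param_hom_mult)

lemma param_hom_const: "param_hom e n (Poly_Mapping.single 0 c) = [:c:]"
  by (simp add: param_hom_single)

lemma param_hom_var: "i < e \<Longrightarrow> param_hom e n (var i) = Polynomial.monom 1 (n i)"
proof -
  assume "i < e"
  have "(\<Prod>j<e. Polynomial.monom 1 (n j) ^ Poly_Mapping.lookup (unit_vec i) j) =
        (\<Prod>j<e. if j = i then Polynomial.monom (1::'a) (n i) else 1)"
    by (rule prod.cong) (auto simp: unit_vec_def lookup_single)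
  with \<open>i < e\<close> show ?thesis
    by (simp add: var_def xpow_def param_hom_single)
qed


section \<open>The generators of the semigroup\<close>

definition gens :: "nat \<Rightarrow> nat \<Rightarrow> nat \<Rightarrow> nat \<Rightarrow> nat \<Rightarrow> nat" where
  "gens e a b d i = (if i \<le> e - 3 then a + i * d else if i = e - 2 then b else b + d)"

lemma gens_image:
  assumes "5 \<le> e"
  shows "gens e a b d ` {..<e} = {a + i * d | i. i \<le> e - 3} \<union> {b, b + d}"
proof -
  have "{..<e} = {..e - 3} \<union> {e - 2, e - 1}" using assms by auto
  moreover have "gens e a b d ` {..e - 3} = {a + i * d | i. i \<le> e - 3}"
    by (auto simp: gens_def image_iff)
  moreover have "gens e a b d (e - 2) = b" "gens e a b d (e - 1) = b + d"
    using assms by (auto simp: gens_def)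
  ultimately show ?thesis by (simp add: image_Un)
qed

end

(*
  Adding eps_0 preserves B, so B is determined by its elements with vanishing 0-th entry. Their
  degrees form the Apery set of the semigroup with respect to a = e + 1, which has e + 1 elements:
  0, the e - 1 minimal generators other than a, and one more. A residue computation modulo a shows
  that the extra element is not of the form 2 eps_p. It follows that every monomial outside B is
  divisible by a quadratic monomial x_i x_j outside B with i, j > 0. The elements of G are exactly
  the binomials that rewrite these quadratic monomials to normal form, hence G is a Groebner basis
  of p(M). It is minimal because each such x_i x_j occurs in exactly one element of G and no
  element of G has terms of degree less than 2.
*)

theory Submission
  imports Defs "HOL-Number_Theory.Cong"
begin

section \<open>Semigroups spanned by weights\<close>

lemma semigroup_span_closed:
  assumes "s \<in> semigroup_span M" "t \<in> semigroup_span M"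
  shows "s + t \<in> semigroup_span M"
  using assms(1) by induction (simp_all add: assms(2) add.assoc semigroup_span.add)

lemma semigroup_span_base: "m \<in> M \<Longrightarrow> m \<in> semigroup_span M"
  using semigroup_span.add[OF _ semigroup_span.zero, of m M] by simp

lemma semigroup_span_mult: "m \<in> semigroup_span M \<Longrightarrow> k * m \<in> semigroup_span M"
  by (induction k) (simp_all add: semigroup_span.zero semigroup_span_closed)

lemma semigroup_span_sum:
  "(\<And>i. i \<in> I \<Longrightarrow> f i \<in> semigroup_span M) \<Longrightarrow> sum f I \<in> semigroup_span M"
  by (induction I rule: infinite_finite_induct)
    (simp_all add: semigroup_span.zero semigroup_span_closed)

lemma semigroup_span_subset:
  assumes "M \<subseteq> semigroup_span N"
  shows "semigroup_span M \<subseteq> semigroup_span N"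
proof
  fix s assume "s \<in> semigroup_span M"
  then show "s \<in> semigroup_span N"
    by induction (use assms in \<open>simp_all add: semigroup_span.zero semigroup_span_closed subset_iff\<close>)
qed

text \<open>The form in which minimality of \<open>M\<close> is used later: irredundancy of a single
  generator.\<close>

lemma minimal_semigroup_generating_set_not_in_span:
  assumes "minimal_semigroup_generating_set M (semigroup_span M)" "m \<in> M"
  shows "m \<notin> semigroup_span (M - {m})"
proof
  assume "m \<in> semigroup_span (M - {m})"
  then have "M \<subseteq> semigroup_span (M - {m})" by (auto intro: semigroup_span_base)
  moreover have "M - {m} \<subseteq> semigroup_span M" by (auto intro: semigroup_span_base)
  ultimately have "semigroup_span (M - {m}) = semigroup_span M"
    using semigroup_span_subset by blast
  moreover have "M - {m} \<subset> M" using assms(2) by auto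
  ultimately show False using assms(1) by (auto simp: minimal_semigroup_generating_set_def)
qed

section \<open>Exponent vectors and weighted degrees\<close>

lemma unit_vec_in_exponents [simp]: "i < e \<Longrightarrow> unit_vec i \<in> exponents e"
  by (simp add: exponents_def unit_vec_def)

lemma lookup_unit_vec: "Poly_Mapping.lookup (unit_vec i) j = (if i = j then 1 else 0)"
  by (simp add: unit_vec_def lookup_single)

lemma lookup_exponents_ge: "\<alpha> \<in> exponents e \<Longrightarrow> e \<le> i \<Longrightarrow> Poly_Mapping.lookup \<alpha> i = 0"
  by (auto simp: exponents_def subset_iff in_keys_iff)

lemma exponents_addD:
  assumes "\<alpha> + \<beta> \<in> exponents e"
  shows "\<alpha> \<in> exponents e" "\<beta> \<in> exponents e"
  using assms by (auto simp: exponents_def subset_iff in_keys_iff lookup_add)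

lemma wdeg_zero [simp]: "wdeg e n 0 = 0"
  by (simp add: wdeg_def)

lemma wdeg_add [simp]: "wdeg e n (\<alpha> + \<beta>) = wdeg e n \<alpha> + wdeg e n \<beta>"
  by (simp add: wdeg_def lookup_add sum.distrib algebra_simps)

lemma wdeg_single: "i < e \<Longrightarrow> wdeg e n (Poly_Mapping.single i k) = k * n i"
proof -
  assume i: "i < e"
  have "wdeg e n (Poly_Mapping.single i k) = (\<Sum>j<e. if j = i then k * n i else 0)"
    unfolding wdeg_def by (rule sum.cong) (auto simp: lookup_single)
  then show ?thesis using i by simp
qed

lemma wdeg_unit_vec [simp]: "i < e \<Longrightarrow> wdeg e n (unit_vec i) = n i"
  by (simp add: unit_vec_def wdeg_single)

lemma exponents_eq_unit_vec_add:
  assumes "0 < Poly_Mapping.lookup \<alpha> i"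
  obtains \<beta> where "\<alpha> = unit_vec i + \<beta>"
proof
  show "\<alpha> = unit_vec i + (\<alpha> - unit_vec i)"
    using assms by (intro poly_mapping_eqI) (auto simp: lookup_add lookup_minus lookup_unit_vec)
qed

lemma nonzero_exponent_eq_unit_vec_add:
  assumes "\<alpha> \<in> exponents e" "\<alpha> \<noteq> 0"
  obtains i \<beta> where "i < e" "\<beta> \<in> exponents e" "\<alpha> = unit_vec i + \<beta>"
proof -
  obtain i where i: "0 < Poly_Mapping.lookup \<alpha> i"
    using assms(2) poly_mapping_eqI[of \<alpha> 0] by auto
  then obtain \<beta> where \<beta>: "\<alpha> = unit_vec i + \<beta>"
    by (rule exponents_eq_unit_vec_add)
  show ?thesis
  proof
    show "i < e" using i lookup_exponents_ge[OF assms(1), of i] by (cases "i < e") auto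
    show "\<beta> \<in> exponents e" using exponents_addD(2) assms(1) \<beta> by blast
  qed (rule \<beta>)
qed

text \<open>Recording the support matters: the degree of a vector that vanishes at index l is
  spanned by the weights of the other indices.\<close>

lemma wdeg_in_span:
  "wdeg e n \<alpha> \<in> semigroup_span (n ` (Poly_Mapping.keys \<alpha> \<inter> {..<e}))"
  unfolding wdeg_def
proof (intro semigroup_span_sum)
  fix i assume i: "i \<in> {..<e}"
  show "Poly_Mapping.lookup \<alpha> i * n i \<in> semigroup_span (n ` (Poly_Mapping.keys \<alpha> \<inter> {..<e}))"
  proof (cases "i \<in> Poly_Mapping.keys \<alpha>")
    case True
    have "n i \<in> n ` (Poly_Mapping.keys \<alpha> \<inter> {..<e})"
      by (rule imageI, rule IntI[OF True i])
    then show ?thesis by (rule semigroup_span_mult[OF semigroup_span_base])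
  next
    case False
    then show ?thesis by (simp add: in_keys_iff semigroup_span.zero)
  qed
qed

lemma semigroup_span_eq_wdeg_image:
  "semigroup_span (n ` {..<e}) = wdeg e n ` exponents e"
proof (intro equalityI subsetI)
  fix s assume "s \<in> semigroup_span (n ` {..<e})"
  then show "s \<in> wdeg e n ` exponents e"
  proof induction
    case zero
    show ?case using exponents_zero by (intro image_eqI[of _ _ 0]) auto
  next
    case (add m s)
    then obtain i \<alpha> where "i < e" "m = n i" "\<alpha> \<in> exponents e" "s = wdeg e n \<alpha>" by auto
    then show ?case
      by (intro image_eqI[of _ _ "unit_vec i + \<alpha>"]) (auto intro: exponents_add)
  qed
next
  fix s assume "s \<in> wdeg e n ` exponents e"
  then obtain \<alpha> where "\<alpha> \<in> exponents e" "s = wdeg e n \<alpha>" by auto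
  then show "s \<in> semigroup_span (n ` {..<e})"
    using wdeg_in_span[of e n \<alpha>] semigroup_span_subset[of "n ` (Poly_Mapping.keys \<alpha> \<inter> {..<e})" "n ` {..<e}"]
    by (auto intro: semigroup_span_base)
qed


section \<open>Lexicographically maximal exponents\<close>

locale positive_weights =
  fixes e :: nat and n :: "nat \<Rightarrow> nat"
  assumes e_pos: "0 < e" and weight_pos: "i < e \<Longrightarrow> 0 < n i"
begin

lemma wdeg_eq_0_imp:
  assumes "\<alpha> \<in> exponents e" "wdeg e n \<alpha> = 0"
  shows "\<alpha> = 0"
proof (rule ccontr)
  assume "\<alpha> \<noteq> 0"
  then obtain i \<beta> where "i < e" "\<alpha> = unit_vec i + \<beta>"
    using assms(1) by (metis nonzero_exponent_eq_unit_vec_add)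
  then show False using assms(2) weight_pos by fastforce
qed

text \<open>The set under \<open>Max\<close> is finite because the weights are positive, and it
  contains \<open>\<alpha>\<close>.\<close>

lemma tau:
  assumes "\<alpha> \<in> exponents e"
  shows tau_in_exponents: "tau e n (wdeg e n \<alpha>) \<in> exponents e"
    and wdeg_tau: "wdeg e n (tau e n (wdeg e n \<alpha>)) = wdeg e n \<alpha>"
    and le_tau: "\<alpha> \<le> tau e n (wdeg e n \<alpha>)"
proof -
  let ?A = "{\<beta> \<in> exponents e. wdeg e n \<beta> = wdeg e n \<alpha>}"
  have fin: "finite ?A" by (rule finite_wdeg_eq) (rule weight_pos)
  have mem: "\<alpha> \<in> ?A" using assms by simp
  have "Max ?A \<in> ?A" using fin mem by (intro Max_in) auto
  then show "tau e n (wdeg e n \<alpha>) \<in> exponents e"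
    "wdeg e n (tau e n (wdeg e n \<alpha>)) = wdeg e n \<alpha>" by (simp_all add: tau_def)
  show "\<alpha> \<le> tau e n (wdeg e n \<alpha>)" unfolding tau_def using fin mem by (intro Max_ge) auto
qed

lemma tau_in_Bset: "\<alpha> \<in> exponents e \<Longrightarrow> tau e n (wdeg e n \<alpha>) \<in> Bset e n"
  by (simp add: Bset_def semigroup_span_eq_wdeg_image)

lemma tau_eq_iff:
  assumes "\<alpha> \<in> exponents e"
  shows "tau e n (wdeg e n \<alpha>) = \<alpha> \<longleftrightarrow> \<alpha> \<in> Bset e n"
proof
  assume "\<alpha> \<in> Bset e n"
  then obtain \<beta> where "\<beta> \<in> exponents e" "\<alpha> = tau e n (wdeg e n \<beta>)"
    by (auto simp: Bset_def semigroup_span_eq_wdeg_image)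
  then show "tau e n (wdeg e n \<alpha>) = \<alpha>" by (simp add: wdeg_tau)
qed (use tau_in_Bset[OF assms] in simp)

lemma Bset_exponents: "\<alpha> \<in> Bset e n \<Longrightarrow> \<alpha> \<in> exponents e"
  by (auto simp: Bset_def semigroup_span_eq_wdeg_image tau_in_exponents)

lemma le_BsetI:
  assumes "\<alpha> \<in> Bset e n" "\<beta> \<in> exponents e" "wdeg e n \<beta> = wdeg e n \<alpha>"
  shows "\<beta> \<le> \<alpha>"
  using le_tau[OF assms(2)] tau_eq_iff[of \<alpha>] assms Bset_exponents by simp

text \<open>Eliminates \<open>tau\<close>: one lexicographically larger vector of the same degree
  refutes membership.\<close>

lemma Bset_iff:
  "\<alpha> \<in> Bset e n \<longleftrightarrow> \<alpha> \<in> exponents e \<and>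
     (\<forall>\<beta>\<in>exponents e. wdeg e n \<beta> = wdeg e n \<alpha> \<longrightarrow> \<beta> \<le> \<alpha>)"
  using le_BsetI Bset_exponents tau_eq_iff tau_in_exponents wdeg_tau le_tau
  by (metis order_antisym)

lemma lookup_0_le:
  fixes \<alpha> \<beta> :: "nat \<Rightarrow>\<^sub>0 nat"
  shows "\<alpha> \<le> \<beta> \<Longrightarrow> Poly_Mapping.lookup \<alpha> 0 \<le> Poly_Mapping.lookup \<beta> 0"
  by (auto simp: le_less less_exponent_iff_lex)

text \<open>Entry 0 is compared first, so a competitor exceeding
  \<open>\<alpha> + unit_vec 0\<close> has positive entry 0. Cancelling eps_0 leaves a vector of the
  degree of \<open>\<alpha>\<close>, which is bounded by \<open>\<alpha>\<close>.\<close>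

lemma Bset_add_unit_vec_0:
  assumes "\<alpha> \<in> Bset e n"
  shows "\<alpha> + unit_vec 0 \<in> Bset e n"
  unfolding Bset_iff
proof (intro conjI ballI impI)
  show "\<alpha> + unit_vec 0 \<in> exponents e"
    using Bset_exponents[OF assms] e_pos by (simp add: exponents_add)
  fix \<beta> assume \<beta>: "\<beta> \<in> exponents e" "wdeg e n \<beta> = wdeg e n (\<alpha> + unit_vec 0)"
  show "\<beta> \<le> \<alpha> + unit_vec 0"
  proof (rule ccontr)
    assume *: "\<not> \<beta> \<le> \<alpha> + unit_vec 0"
    then have "Poly_Mapping.lookup (\<alpha> + unit_vec 0) 0 \<le> Poly_Mapping.lookup \<beta> 0" by (intro lookup_0_le) simp
    then have "0 < Poly_Mapping.lookup \<beta> 0" by (simp add: lookup_add lookup_unit_vec)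
    then obtain \<gamma> where \<gamma>: "\<beta> = unit_vec 0 + \<gamma>" by (rule exponents_eq_unit_vec_add)
    then have "\<gamma> \<le> \<alpha>"
      using \<beta> exponents_addD(2) e_pos by (intro le_BsetI[OF assms]) auto
    with * \<gamma> show False by (simp add: add.commute)
  qed
qed

text \<open>The degrees of the elements of \<^term>\<open>Bset e n\<close> with vanishing first entry form the
  Apery set of the semigroup with respect to \<^term>\<open>n 0\<close>.\<close>

lemma Bset_cong_imp_eq:
  assumes "\<alpha> \<in> Bset e n" "Poly_Mapping.lookup \<alpha> 0 = 0" "\<beta> \<in> Bset e n" "Poly_Mapping.lookup \<beta> 0 = 0"
    and "[wdeg e n \<alpha> = wdeg e n \<beta>] (mod n 0)"
  shows "\<alpha> = \<beta>"
proof -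
  have *: "\<alpha> = \<beta>" if \<alpha>: "\<alpha> \<in> Bset e n" and \<beta>: "\<beta> \<in> Bset e n" "Poly_Mapping.lookup \<beta> 0 = 0"
    and le: "wdeg e n \<alpha> \<le> wdeg e n \<beta>"
    and cong: "[wdeg e n \<alpha> = wdeg e n \<beta>] (mod n 0)" for \<alpha> \<beta>
  proof -
    obtain k where k: "wdeg e n \<beta> = k * n 0 + wdeg e n \<alpha>"
      using cong le cong_le_nat[of "wdeg e n \<alpha>" "wdeg e n \<beta>" "n 0"] cong_sym by blast
    \<comment> \<open>Adding k copies of eps_0 lifts \<open>\<alpha>\<close> to the degree of
      \<open>\<beta>\<close>. As \<open>\<beta>\<close> is maximal there and has entry 0 equal to 0,
      k vanishes.\<close>
    have "\<alpha> + Poly_Mapping.single 0 k \<le> \<beta>"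
      using Bset_exponents[OF \<alpha>] e_pos k
      by (intro le_BsetI[OF \<beta>(1)] exponents_add) (auto simp: exponents_def wdeg_single)
    from lookup_0_le[OF this] \<beta>(2) have "k = 0" by (simp add: lookup_add)
    with k have "wdeg e n \<alpha> = wdeg e n \<beta>" by simp
    with \<alpha> \<beta>(1) show ?thesis using tau_eq_iff Bset_exponents by metis
  qed
  show ?thesis
    using *[of \<alpha> \<beta>] *[of \<beta> \<alpha>] assms cong_sym by (metis nat_le_linear)
qed

end


section \<open>Sums of unit vectors and the Apery set\<close>

lemma unit_vec_eq_iff [simp]: "unit_vec i = unit_vec j \<longleftrightarrow> i = j"
  by (metis lookup_unit_vec zero_neq_one)

lemma unit_vec_neq_0 [simp]: "unit_vec i \<noteq> 0" "0 \<noteq> unit_vec i"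
  using lookup_unit_vec[of i i] by auto

lemma unit_vec_add_neq_unit_vec [simp]: "unit_vec i + unit_vec j \<noteq> unit_vec l"
proof
  assume *: "unit_vec i + unit_vec j = unit_vec l"
  have "Poly_Mapping.lookup (unit_vec i + unit_vec j) i = Poly_Mapping.lookup (unit_vec l) i"
    "Poly_Mapping.lookup (unit_vec i + unit_vec j) j = Poly_Mapping.lookup (unit_vec l) j" by (simp_all only: *)
  then have "i = l" "j = l" by (auto simp: lookup_add lookup_unit_vec split: if_splits)
  with * show False by simp
qed

lemma add_neq_0:
  fixes \<alpha> \<beta> :: "nat \<Rightarrow>\<^sub>0 nat"
  assumes "\<alpha> \<noteq> 0"
  shows "\<alpha> + \<beta> \<noteq> 0"
proof
  assume *: "\<alpha> + \<beta> = 0"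
  have "Poly_Mapping.lookup \<alpha> i = 0" for i
    using arg_cong[OF *, of "\<lambda>f. Poly_Mapping.lookup f i"] by (simp add: lookup_add)
  then have "\<alpha> = 0" by (intro poly_mapping_eqI) simp
  with assms show False by contradiction
qed

lemma add_eq_unit_vecD:
  assumes "\<alpha> + \<beta> = unit_vec l" "\<alpha> \<noteq> 0"
  shows "\<beta> = 0"
proof -
  have l: "Poly_Mapping.lookup \<alpha> k + Poly_Mapping.lookup \<beta> k = (if l = k then 1 else 0)" for k
    using arg_cong[OF assms(1), of "\<lambda>f. Poly_Mapping.lookup f k"] by (simp add: lookup_add lookup_unit_vec)
  obtain i where "Poly_Mapping.lookup \<alpha> i \<noteq> 0" using assms(2) poly_mapping_eqI[of \<alpha> 0] by auto
  then have "Poly_Mapping.lookup \<alpha> l \<noteq> 0" using l[of i] by (cases "l = i") auto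
  then have "Poly_Mapping.lookup \<beta> k = 0" for k using l[of k] l[of l] by (cases "k = l") auto
  then show ?thesis by (intro poly_mapping_eqI) simp
qed

text \<open>The semigroup has multiplicity \<open>e + 1\<close> and embedding dimension \<open>e\<close>, so besides \<open>0\<close> and the
  minimal generators the Apery set has exactly one further element.\<close>

locale almost_maximal_weights = positive_weights +
  assumes weight_0: "n 0 = e + 1"
    and weight_indecomposable:
      "\<alpha> \<in> exponents e \<Longrightarrow> l < e \<Longrightarrow> wdeg e n \<alpha> = n l \<Longrightarrow> \<alpha> = unit_vec l"
begin

lemma zero_in_Bset: "0 \<in> Bset e n"
  unfolding Bset_iff using exponents_zero wdeg_eq_0_imp by auto

lemma unit_vec_in_Bset: "l < e \<Longrightarrow> unit_vec l \<in> Bset e n"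
  unfolding Bset_iff using weight_indecomposable by fastforce

text \<open>Pigeonhole: two extra elements together with 0 and the e - 1 unit vectors of positive
  index would be e + 2 elements with distinct residues modulo e + 1.\<close>

lemma Bset_extra_unique:
  assumes "\<alpha> \<in> Bset e n" "Poly_Mapping.lookup \<alpha> 0 = 0" "\<alpha> \<noteq> 0" "\<alpha> \<notin> range unit_vec"
    and "\<beta> \<in> Bset e n" "Poly_Mapping.lookup \<beta> 0 = 0" "\<beta> \<noteq> 0" "\<beta> \<notin> range unit_vec"
  shows "\<alpha> = \<beta>"
proof (rule ccontr)
  assume ne: "\<alpha> \<noteq> \<beta>"
  define S where "S = insert \<alpha> (insert \<beta> (insert 0 (unit_vec ` {1..<e})))"
  have "inj_on unit_vec {1..<e}" by (simp add: inj_on_def)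
  then have "card (unit_vec ` {1..<e}) = e - 1" by (simp add: card_image)
  then have card: "card S = e + 2"
    using assms ne e_pos by (auto simp: S_def card_insert_if)
  have S: "\<gamma> \<in> Bset e n \<and> Poly_Mapping.lookup \<gamma> 0 = 0" if "\<gamma> \<in> S" for \<gamma>
    using that assms unit_vec_in_Bset zero_in_Bset by (auto simp: S_def lookup_unit_vec)
  have "inj_on (\<lambda>\<gamma>. wdeg e n \<gamma> mod n 0) S"
    using S Bset_cong_imp_eq by (auto simp: inj_on_def cong_def)
  moreover have "(\<lambda>\<gamma>. wdeg e n \<gamma> mod n 0) ` S \<subseteq> {..<n 0}"
    using e_pos weight_pos by auto
  ultimately have "card S \<le> card {..<n 0}" by (intro card_inj_on_le) auto
  then show False using card weight_0 by simp
qed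

text \<open>The shifts removed in \<open>Bset_i'\<close> contain no unit vector: only 0 can be
  shifted to one, and 0 is not in \<open>Bset_i e n i\<close> because eps_i lies in B.\<close>

lemma unit_vec_in_Bset_i'_iff:
  assumes "i < e" "1 \<le> j" "j < e"
  shows "unit_vec j \<in> Bset_i' e n i \<longleftrightarrow> unit_vec i + unit_vec j \<notin> Bset e n"
proof -
  have "unit_vec j \<notin> (\<lambda>\<alpha>. \<alpha> + unit_vec l) ` Bset_i e n i" for l
  proof clarify
    fix \<alpha> assume "unit_vec j = \<alpha> + unit_vec l" and \<alpha>: "\<alpha> \<in> Bset_i e n i"
    then have "\<alpha> = 0" using add_eq_unit_vecD[of "unit_vec l" \<alpha> j] by (simp add: add.commute)
    with \<alpha> show False using unit_vec_in_Bset[OF assms(1)] by (simp add: Bset_i_def)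
  qed
  then have "unit_vec j \<in> Bset_i' e n i \<longleftrightarrow> unit_vec j \<in> Bset_i e n i"
    by (auto simp: Bset_i'_def)
  also have "\<dots> \<longleftrightarrow> unit_vec i + unit_vec j \<notin> Bset e n"
    using unit_vec_in_Bset[OF assms(3)] by (simp add: Bset_i_def add.commute)
  finally show ?thesis .
qed

text \<open>If \<open>\<epsilon>\<^sub>i + \<epsilon>\<^sub>j + \<epsilon>\<^sub>k\<close> divides an exponent whose quadratic divisors all lie in \<^term>\<open>Bset e n\<close>,
  then these three pairs all equal the extra element of the Apery set, which forces
  \<open>i = j = k\<close>.\<close>

lemma quadratic_divisor:
  assumes "\<And>p. 1 \<le> p \<Longrightarrow> p < e \<Longrightarrow> unit_vec p + unit_vec p \<notin> Bset e n"
    and "\<alpha> \<in> exponents e" "\<alpha> \<notin> Bset e n"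
  obtains i j \<beta> where "1 \<le> i" "i \<le> j" "j < e" "\<beta> \<in> exponents e"
    "unit_vec i + unit_vec j \<notin> Bset e n" "\<alpha> = unit_vec i + unit_vec j + \<beta>"
proof -
  \<comment> \<open>The order of i and j is left open here and restored at the end by
    swapping.\<close>
  have "\<exists>i j \<beta>. 1 \<le> i \<and> 1 \<le> j \<and> i < e \<and> j < e \<and>
     unit_vec i + unit_vec j \<notin> Bset e n \<and> \<alpha> = unit_vec i + unit_vec j + \<beta>"
    using assms(2,3)
  proof (induction "Poly_Mapping.lookup \<alpha> 0" arbitrary: \<alpha>)
    case 0
    show ?case
    proof (rule ccontr)
      assume "\<not> ?case"
      then have quad: "unit_vec i + unit_vec j \<in> Bset e n"
        if "\<alpha> = unit_vec i + unit_vec j + \<beta>" "i < e" "j < e" "1 \<le> i" "1 \<le> j" for i j \<beta>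
        using that by blast
      have "\<alpha> \<noteq> 0" using 0 zero_in_Bset by auto
      then obtain i \<beta> where i: "i < e" "\<beta> \<in> exponents e" "\<alpha> = unit_vec i + \<beta>"
        using nonzero_exponent_eq_unit_vec_add[OF 0(2)] by blast
      have "\<beta> \<noteq> 0" using 0 i unit_vec_in_Bset by auto
      then obtain j \<gamma> where j: "j < e" "\<gamma> \<in> exponents e" "\<beta> = unit_vec j + \<gamma>"
        using nonzero_exponent_eq_unit_vec_add[OF i(2)] by blast
      have ij: "1 \<le> i" "1 \<le> j"
        using 0(1) i(3) j(3) by (auto simp: lookup_add lookup_unit_vec split: if_splits)
      have 1: "unit_vec i + unit_vec j \<in> Bset e n"
        using i j ij by (intro quad) (auto simp: algebra_simps)
      \<comment> \<open>The quadratic part lies in B but \<open>\<alpha>\<close> does not, so a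
        third unit vector can be split off.\<close>
      then have "\<gamma> \<noteq> 0" using 0 i j by (auto simp: add.assoc)
      then obtain k \<delta> where k: "k < e" "\<delta> \<in> exponents e" "\<gamma> = unit_vec k + \<delta>"
        using nonzero_exponent_eq_unit_vec_add[OF j(2)] by blast
      have k1: "1 \<le> k"
        using 0(1) i(3) j(3) k(3) by (auto simp: lookup_add lookup_unit_vec split: if_splits)
      have 2: "unit_vec j + unit_vec k \<in> Bset e n"
        using i j k ij k1 by (intro quad[of _ _ "unit_vec i + \<delta>"]) (auto simp: algebra_simps)
      have 3: "unit_vec i + unit_vec k \<in> Bset e n"
        using i j k ij k1 by (intro quad[of _ _ "unit_vec j + \<delta>"]) (auto simp: algebra_simps)
      have eq: "unit_vec x + unit_vec y = unit_vec z + unit_vec w"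
        if "unit_vec x + unit_vec y \<in> Bset e n" "unit_vec z + unit_vec w \<in> Bset e n"
          "1 \<le> x" "1 \<le> y" "1 \<le> z" "1 \<le> w" for x y z w
        using that
        by (intro Bset_extra_unique) (auto simp: lookup_add lookup_unit_vec add_neq_0)
      have "unit_vec i + unit_vec j = unit_vec k + unit_vec j"
        using eq[OF 1 2] ij k1 by (simp add: add.commute)
      moreover have "unit_vec i + unit_vec j = unit_vec i + unit_vec k"
        using eq[OF 1 3] ij k1 by simp
      ultimately have "i = k" "j = k" by simp_all
      with 1 ij k1 k(1) assms(1)[of k] show False by simp
    qed
  next
    case (Suc m)
    then obtain \<alpha>' where \<alpha>': "\<alpha> = unit_vec 0 + \<alpha>'"
      using exponents_eq_unit_vec_add[of \<alpha> 0] by auto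
    \<comment> \<open>Otherwise adding eps_0 would put \<open>\<alpha>\<close> into B.\<close>
    have "\<alpha>' \<notin> Bset e n" using Suc(4) Bset_add_unit_vec_0 \<alpha>' by (metis add.commute)
    moreover have "m = Poly_Mapping.lookup \<alpha>' 0" "\<alpha>' \<in> exponents e"
      using Suc(2,3) \<alpha>' exponents_addD(2) by (auto simp: lookup_add lookup_unit_vec)
    ultimately obtain i j \<beta> where "1 \<le> i" "1 \<le> j" "i < e" "j < e"
      "unit_vec i + unit_vec j \<notin> Bset e n" "\<alpha>' = unit_vec i + unit_vec j + \<beta>"
      using Suc(1) by blast
    moreover from this(6) have "\<alpha> = unit_vec i + unit_vec j + (unit_vec 0 + \<beta>)"
      using \<alpha>' by (simp add: algebra_simps)
    ultimately show ?case by blast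
  qed
  then obtain i j \<beta> where *: "1 \<le> i" "1 \<le> j" "i < e" "j < e"
    "unit_vec i + unit_vec j \<notin> Bset e n" "\<alpha> = unit_vec i + unit_vec j + \<beta>" by blast
  then have \<beta>: "\<beta> \<in> exponents e" using assms(2) exponents_addD(2) by blast
  show ?thesis
  proof (cases "i \<le> j")
    case True
    with * \<beta> that show ?thesis by blast
  next
    case False
    with * \<beta> that[of j i \<beta>] show ?thesis by (simp add: add.commute)
  qed
qed

end


text \<open>Makes the pair recoverable from the monomial x_i x_j, so that distinct generators have
  distinct quadratic monomials.\<close>

lemma unit_vec_add_eq_sorted:
  assumes "unit_vec i + unit_vec j = unit_vec k + unit_vec l" "i \<le> j" "k \<le> l"
  shows "i = k \<and> j = l"
proof -
  have *: "Poly_Mapping.lookup (unit_vec i + unit_vec j) x = Poly_Mapping.lookup (unit_vec k + unit_vec l) x" for x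
    by (simp only: assms(1))
  have "k = i \<or> l = i" using *[of i] by (auto simp: lookup_add lookup_unit_vec split: if_splits)
  moreover have "i = k \<or> j = k"
    using *[of k] by (auto simp: lookup_add lookup_unit_vec split: if_splits)
  ultimately have "i = k" using assms(2,3) by auto
  with assms(1) show ?thesis by simp
qed

section \<open>The defining ideal\<close>

lemma mpoly_ring_simps [simp]:
  "p \<in> carrier (mpoly_ring e) \<longleftrightarrow> Poly_Mapping.keys p \<subseteq> exponents e"
  "mult (mpoly_ring e) = (*)" "add (mpoly_ring e) = (+)"
  "zero (mpoly_ring e) = 0" "one (mpoly_ring e) = 1"
  by (simp_all add: mpoly_ring_def)

lemma a_inv_mpoly_ring:
  assumes "p \<in> carrier (mpoly_ring e)"
  shows "\<ominus>\<^bsub>mpoly_ring e\<^esub> p = - p"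
proof -
  interpret R: cring "mpoly_ring e :: ((nat \<Rightarrow>\<^sub>0 nat) \<Rightarrow>\<^sub>0 'a) ring" by (rule cring_mpoly_ring)
  show ?thesis using assms by (intro R.minus_equality) auto
qed

lemma ideal_mpoly_ringI:
  fixes I :: "((nat \<Rightarrow>\<^sub>0 nat) \<Rightarrow>\<^sub>0 'k::field) set"
  assumes carr: "I \<subseteq> carrier (mpoly_ring e)" and "0 \<in> I"
    and add: "\<And>p q. p \<in> I \<Longrightarrow> q \<in> I \<Longrightarrow> p + q \<in> I"
    and mult: "\<And>p q. p \<in> I \<Longrightarrow> q \<in> carrier (mpoly_ring e) \<Longrightarrow> p * q \<in> I"
  shows "ideal I (mpoly_ring e)"
proof -
  interpret R: cring "mpoly_ring e :: ((nat \<Rightarrow>\<^sub>0 nat) \<Rightarrow>\<^sub>0 'k) ring" by (rule cring_mpoly_ring)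
  \<comment> \<open>Negation is multiplication by the constant -1.\<close>
  have minus: "- p \<in> I" if "p \<in> I" for p
    using mult[OF that, of "-1"] exponents_zero by simp
  show ?thesis
  proof (rule idealI)
    show "subgroup I (add_monoid (mpoly_ring e))"
    proof (rule R.add.subgroupI)
      fix p assume p: "p \<in> I"
      then show "\<ominus>\<^bsub>mpoly_ring e\<^esub> p \<in> I"
        using carr a_inv_mpoly_ring[of p e] minus by auto
    qed (use assms in \<open>auto simp del: mpoly_ring_simps(1)\<close>)
    fix p q :: "(nat \<Rightarrow>\<^sub>0 nat) \<Rightarrow>\<^sub>0 'k" assume "p \<in> I" "q \<in> carrier (mpoly_ring e)"
    then show "q \<otimes>\<^bsub>mpoly_ring e\<^esub> p \<in> I" "p \<otimes>\<^bsub>mpoly_ring e\<^esub> q \<in> I"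
      using mult[of p q] by (simp_all add: mult.commute)
  qed (rule R.ring_axioms)
qed

lemma
  fixes I :: "((nat \<Rightarrow>\<^sub>0 nat) \<Rightarrow>\<^sub>0 'k::field) set"
  assumes "ideal I (mpoly_ring e)"
  shows ideal_mpoly_ring_zero: "0 \<in> I"
    and ideal_mpoly_ring_add: "p \<in> I \<Longrightarrow> q \<in> I \<Longrightarrow> p + q \<in> I"
    and ideal_mpoly_ring_mult: "p \<in> I \<Longrightarrow> q \<in> carrier (mpoly_ring e) \<Longrightarrow> q * p \<in> I"
proof -
  interpret ideal I "mpoly_ring e" by (rule assms)
  show "0 \<in> I" using additive_subgroup.zero_closed[OF is_additive_subgroup] by simp
  show "p \<in> I \<Longrightarrow> q \<in> I \<Longrightarrow> p + q \<in> I"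
    using additive_subgroup.a_closed[OF is_additive_subgroup, of p q] by simp
  show "p \<in> I \<Longrightarrow> q \<in> carrier (mpoly_ring e) \<Longrightarrow> q * p \<in> I"
    using I_l_closed[of p q] by simp
qed

lemma ideal_mpoly_ring_sum:
  assumes "ideal I (mpoly_ring e)" "\<And>a. a \<in> A \<Longrightarrow> g a \<in> I"
  shows "sum g A \<in> I"
  using assms(2)
  by (induction A rule: infinite_finite_induct)
    (simp_all add: ideal_mpoly_ring_zero[OF assms(1)] ideal_mpoly_ring_add[OF assms(1)])

text \<open>\<open>D\<close> is closed under divisors, so a key of \<open>p * q\<close> in
  \<open>D\<close> would yield a key of \<open>p\<close> in \<open>D\<close>.\<close>

lemma ideal_lookup_eq_0:
  fixes D :: "(nat \<Rightarrow>\<^sub>0 nat) set"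
  assumes "\<And>\<alpha> \<beta>. \<alpha> + \<beta> \<in> D \<Longrightarrow> \<alpha> \<in> D"
  shows "ideal {p \<in> carrier (mpoly_ring e). Poly_Mapping.keys p \<inter> D = {}}
    (mpoly_ring e :: ((nat \<Rightarrow>\<^sub>0 nat) \<Rightarrow>\<^sub>0 'k::field) ring)"
proof (rule ideal_mpoly_ringI, goal_cases)
  case (3 p q)
  then show ?case using Poly_Mapping.keys_add[of p q] by auto
next
  case (4 p q)
  interpret R: cring "mpoly_ring e :: ((nat \<Rightarrow>\<^sub>0 nat) \<Rightarrow>\<^sub>0 'k) ring" by (rule cring_mpoly_ring)
  have "p * q \<in> carrier (mpoly_ring e)"
    using R.m_closed[of p q] 4 by simp
  moreover have "Poly_Mapping.keys (p * q) \<inter> D = {}"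
    using Poly_Mapping.keys_mult[of p q] 4 assms by blast
  ultimately show ?case by blast
qed auto

section \<open>Monomials, binomials and the kernel of the parametrization\<close>

lemma xpow_in_carrier [simp]: "\<alpha> \<in> exponents e \<Longrightarrow> Poly_Mapping.keys (xpow \<alpha>) \<subseteq> exponents e"
  by (simp add: xpow_def)

lemma xpow_mult: "xpow \<alpha> * xpow \<beta> = xpow (\<alpha> + \<beta>)"
  by (simp add: xpow_def mult_single)

lemma fpoly_eq: "fpoly e n \<alpha> i =
    xpow (unit_vec i + \<alpha>) - xpow (tau e n (wdeg e n (unit_vec i + \<alpha>)))"
  by (simp add: fpoly_def var_def xpow_mult add.commute)

lemma param_hom_xpow: "param_hom e n (xpow \<alpha>) = Polynomial.monom 1 (wdeg e n \<alpha>)"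
proof -
  have "(\<Prod>i\<in>A. Polynomial.monom (1::'a) (n i) ^ Poly_Mapping.lookup \<alpha> i) =
      Polynomial.monom 1 (\<Sum>i\<in>A. Poly_Mapping.lookup \<alpha> i * n i)" for A
    by (induction A rule: infinite_finite_induct)
      (simp_all add: monom_power mult_monom mult.commute)
  then show ?thesis by (simp add: xpow_def param_hom_single wdeg_def)
qed

lemma defining_ideal_iff:
  "p \<in> defining_ideal e n \<longleftrightarrow> p \<in> carrier (mpoly_ring e) \<and> param_hom e n p = 0"
  by (simp add: defining_ideal_def a_kernel_def' upoly_ring_def)

lemma ideal_defining_ideal:
  "ideal (defining_ideal e n) (mpoly_ring e :: ((nat \<Rightarrow>\<^sub>0 nat) \<Rightarrow>\<^sub>0 'k::field) ring)"
proof -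
  interpret R: cring "mpoly_ring e :: ((nat \<Rightarrow>\<^sub>0 nat) \<Rightarrow>\<^sub>0 'k) ring" by (rule cring_mpoly_ring)
  show ?thesis
  proof (rule ideal_mpoly_ringI, goal_cases)
    case (3 p q)
    then show ?case using R.a_closed[of p q] by (simp add: defining_ideal_iff param_hom_add)
  next
    case (4 p q)
    then show ?case using R.m_closed[of p q] by (simp add: defining_ideal_iff param_hom_mult)
  qed (auto simp: defining_ideal_iff param_hom_def[of _ _ 0])
qed

text \<open>Monomials map to powers of t, so \<open>p\<close> is killed exactly when its
  coefficients sum to 0 in every degree.\<close>

lemma coeff_param_hom:
  "coeff (param_hom e n p) s = (\<Sum>\<alpha>\<in>Poly_Mapping.keys p. if wdeg e n \<alpha> = s then Poly_Mapping.lookup p \<alpha> else 0)"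
proof -
  have "param_hom e n p = (\<Sum>\<alpha>\<in>Poly_Mapping.keys p. Polynomial.smult (Poly_Mapping.lookup p \<alpha>) (param_hom e n (xpow \<alpha>)))"
    by (simp add: param_hom_def[of _ _ p] xpow_def param_hom_single)
  then show ?thesis by (simp add: param_hom_xpow coeff_sum if_distrib cong: if_cong)
qed

context positive_weights
begin

lemma binomial_in_defining_ideal:
  assumes "\<alpha> \<in> exponents e"
  shows "xpow \<alpha> - xpow (tau e n (wdeg e n \<alpha>)) \<in> defining_ideal e n"
proof -
  let ?\<tau> = "tau e n (wdeg e n \<alpha>)"
  have "Poly_Mapping.keys (xpow \<alpha> - xpow ?\<tau>) \<subseteq> exponents e"
    using assms tau_in_exponents[OF assms] keys_diff[of "xpow \<alpha>" "xpow ?\<tau>"]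
    by (auto simp: xpow_def)
  moreover have "param_hom e n (xpow \<alpha> - xpow ?\<tau>) = 0"
    using param_hom_add[of e n "xpow \<alpha> - xpow ?\<tau>" "xpow ?\<tau>"]
    by (simp add: param_hom_xpow wdeg_tau[OF assms])
  ultimately show ?thesis by (simp add: defining_ideal_iff)
qed

text \<open>Replace each monomial of \<open>p\<close> by its normal form. The coefficient of the
  result \<open>r\<close> at a normal form is a coefficient of the image of \<open>p\<close>, hence
  \<open>r = 0\<close>, and \<open>p = p - r\<close> is a combination of the binomials.\<close>

lemma defining_ideal_subset:
  fixes I :: "((nat \<Rightarrow>\<^sub>0 nat) \<Rightarrow>\<^sub>0 'k::field) set"
  assumes "ideal I (mpoly_ring e)"
    and bin: "\<And>\<alpha>. \<alpha> \<in> exponents e \<Longrightarrow> xpow \<alpha> - xpow (tau e n (wdeg e n \<alpha>)) \<in> I"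
  shows "defining_ideal e n \<subseteq> I"
proof
  fix p :: "(nat \<Rightarrow>\<^sub>0 nat) \<Rightarrow>\<^sub>0 'k" assume "p \<in> defining_ideal e n"
  then have p: "Poly_Mapping.keys p \<subseteq> exponents e" "param_hom e n p = 0"
    by (simp_all add: defining_ideal_iff)
  define r where "r = (\<Sum>\<alpha>\<in>Poly_Mapping.keys p. Poly_Mapping.single (tau e n (wdeg e n \<alpha>)) (Poly_Mapping.lookup p \<alpha>))"
  \<comment> \<open>Distinct degrees have distinct normal forms, so \<open>r\<close> merges only
    monomials of equal degree.\<close>
  have tau_inj: "tau e n (wdeg e n \<alpha>) = tau e n (wdeg e n \<beta>) \<longleftrightarrow> wdeg e n \<alpha> = wdeg e n \<beta>"
    if "\<alpha> \<in> Poly_Mapping.keys p" "\<beta> \<in> Poly_Mapping.keys p" for \<alpha> \<beta>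
    using that p(1) wdeg_tau[of \<alpha>] wdeg_tau[of \<beta>] by (metis subsetD)
  have "Poly_Mapping.lookup r \<gamma> = 0" for \<gamma>
  proof -
    have r: "Poly_Mapping.lookup r \<gamma> = (\<Sum>\<alpha>\<in>Poly_Mapping.keys p. if tau e n (wdeg e n \<alpha>) = \<gamma> then Poly_Mapping.lookup p \<alpha> else 0)"
      by (simp add: r_def lookup_sum lookup_single when_def)
    show ?thesis
    proof (cases "\<exists>\<beta>\<in>Poly_Mapping.keys p. \<gamma> = tau e n (wdeg e n \<beta>)")
      case True
      then obtain \<beta> where \<beta>: "\<beta> \<in> Poly_Mapping.keys p" "\<gamma> = tau e n (wdeg e n \<beta>)" by blast
      have "Poly_Mapping.lookup r \<gamma> = coeff (param_hom e n p) (wdeg e n \<beta>)"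
        unfolding r coeff_param_hom using \<beta> tau_inj by (intro sum.cong) auto
      then show ?thesis using p(2) by simp
    next
      case False
      then show ?thesis unfolding r by (intro sum.neutral) auto
    qed
  qed
  then have "r = 0" by (intro poly_mapping_eqI) simp
  moreover have "p - r = (\<Sum>\<alpha>\<in>Poly_Mapping.keys p. Poly_Mapping.single 0 (Poly_Mapping.lookup p \<alpha>) *
      (xpow \<alpha> - xpow (tau e n (wdeg e n \<alpha>))))"
    by (subst (1) poly_mapping_sum_single)
      (simp add: r_def sum_subtractf right_diff_distrib xpow_def mult_single)
  ultimately have "p = (\<Sum>\<alpha>\<in>Poly_Mapping.keys p. Poly_Mapping.single 0 (Poly_Mapping.lookup p \<alpha>) *
      (xpow \<alpha> - xpow (tau e n (wdeg e n \<alpha>))))" by simp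
  also have "\<dots> \<in> I"
    using bin p(1) exponents_zero
    by (intro ideal_mpoly_ring_sum[OF assms(1)] ideal_mpoly_ring_mult[OF assms(1)]) auto
  finally show "p \<in> I" .
qed

end

section \<open>The quadratic binomials as a minimal generating set\<close>

context almost_maximal_weights
begin

text \<open>The set \<open>G\<close> of the theorem, with its condition on \<open>Bset_i'\<close>
  rewritten by \<open>unit_vec_in_Bset_i'_iff\<close>.\<close>

definition quadratic_binomials :: "((nat \<Rightarrow>\<^sub>0 nat) \<Rightarrow>\<^sub>0 'k::field) set" where
  "quadratic_binomials = {fpoly e n (unit_vec j) i | i j.
     1 \<le> i \<and> i \<le> j \<and> j < e \<and> unit_vec i + unit_vec j \<notin> Bset e n}"

lemma quadratic_binomials_subset: "quadratic_binomials \<subseteq> defining_ideal e n"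
  by (auto simp: quadratic_binomials_def fpoly_eq exponents_add
      simp del: wdeg_add intro!: binomial_in_defining_ideal)

text \<open>Each reduction step replaces an exponent by a lexicographically larger one of the same
  degree, and there are only finitely many of these.\<close>

lemma binomial_in_ideal:
  fixes I :: "((nat \<Rightarrow>\<^sub>0 nat) \<Rightarrow>\<^sub>0 'k::field) set"
  assumes "\<And>p. 1 \<le> p \<Longrightarrow> p < e \<Longrightarrow> unit_vec p + unit_vec p \<notin> Bset e n"
    and I: "ideal I (mpoly_ring e)" "quadratic_binomials \<subseteq> I"
    and "\<alpha> \<in> exponents e"
  shows "xpow \<alpha> - xpow (tau e n (wdeg e n \<alpha>)) \<in> I"
  using assms(4)
proof (induction "card {\<beta> \<in> exponents e. wdeg e n \<beta> = wdeg e n \<alpha> \<and> \<alpha> < \<beta>}"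
    arbitrary: \<alpha> rule: less_induct)
  case less
  show ?case
  proof (cases "\<alpha> \<in> Bset e n")
    case True
    then show ?thesis using tau_eq_iff[OF less.prems] ideal_mpoly_ring_zero[OF I(1)] by simp
  next
    case False
    then obtain i j \<beta> where ij: "1 \<le> i" "i \<le> j" "j < e" "\<beta> \<in> exponents e"
      "unit_vec i + unit_vec j \<notin> Bset e n" and \<alpha>: "\<alpha> = unit_vec i + unit_vec j + \<beta>"
      using quadratic_divisor[OF assms(1) less.prems] by blast
    define \<sigma> where "\<sigma> = unit_vec i + unit_vec j"
    define \<tau> where "\<tau> = tau e n (wdeg e n \<sigma>)"
    have \<sigma>: "\<sigma> \<in> exponents e" using ij by (simp add: \<sigma>_def exponents_add)
    have "\<sigma> \<noteq> \<tau>" using ij tau_eq_iff[OF \<sigma>] by (auto simp: \<sigma>_def \<tau>_def)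
    then have \<tau>: "\<tau> \<in> exponents e" "wdeg e n \<tau> = wdeg e n \<sigma>" "\<sigma> < \<tau>"
      using tau_in_exponents[OF \<sigma>] wdeg_tau[OF \<sigma>] le_tau[OF \<sigma>] by (auto simp: \<tau>_def)
    define \<alpha>' where "\<alpha>' = \<tau> + \<beta>"
    have \<alpha>': "\<alpha>' \<in> exponents e" "wdeg e n \<alpha>' = wdeg e n \<alpha>" "\<alpha> < \<alpha>'"
      using \<tau> ij(4) by (simp_all add: \<alpha>'_def \<alpha> exponents_add flip: \<sigma>_def)
    \<comment> \<open>The inclusion is strict because \<open>\<alpha>'\<close> lies only in the
      second set.\<close>
    have "{\<beta> \<in> exponents e. wdeg e n \<beta> = wdeg e n \<alpha>' \<and> \<alpha>' < \<beta>}
        \<subset> {\<beta> \<in> exponents e. wdeg e n \<beta> = wdeg e n \<alpha> \<and> \<alpha> < \<beta>}"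
      using \<alpha>' by fastforce
    moreover have "finite {\<beta> \<in> exponents e. wdeg e n \<beta> = wdeg e n \<alpha> \<and> \<alpha> < \<beta>}"
      by (rule finite_subset[OF _ finite_wdeg_eq[of e n "wdeg e n \<alpha>", OF weight_pos]]) auto
    ultimately have "xpow \<alpha>' - xpow (tau e n (wdeg e n \<alpha>')) \<in> I"
      using \<alpha>'(1) by (intro less.hyps psubset_card_mono) auto
    moreover have "xpow \<beta> * fpoly e n (unit_vec j) i \<in> I"
      using ij I(2) by (intro ideal_mpoly_ring_mult[OF I(1)]) (auto simp: quadratic_binomials_def)
    ultimately have "xpow \<beta> * fpoly e n (unit_vec j) i +
        (xpow \<alpha>' - xpow (tau e n (wdeg e n \<alpha>'))) \<in> I"
      using ideal_mpoly_ring_add[OF I(1)] by blast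
    \<comment> \<open>The sum telescopes, since \<open>\<alpha>\<close> and \<open>\<alpha>'\<close>
      have the same normal form.\<close>
    moreover have "xpow \<beta> * fpoly e n (unit_vec j) i =
        xpow \<alpha> - (xpow \<alpha>' :: (nat \<Rightarrow>\<^sub>0 nat) \<Rightarrow>\<^sub>0 'k)"
      by (simp add: fpoly_eq right_diff_distrib xpow_mult \<alpha> \<alpha>'_def add.commute
          flip: \<sigma>_def \<tau>_def)
    ultimately show ?thesis using \<alpha>'(2) by simp
  qed
qed

text \<open>Minimality: the polynomials having no monomial that divides \<open>x\<^sub>i x\<^sub>j\<close> form an ideal,
  which contains every quadratic binomial except \<open>f (\<epsilon>\<^sub>j, i)\<close>.\<close>

theorem quadratic_binomials_minimal:
  assumes "\<And>p. 1 \<le> p \<Longrightarrow> p < e \<Longrightarrow> unit_vec p + unit_vec p \<notin> Bset e n"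
  shows "minimal_ideal_generating_set (mpoly_ring e)
    (quadratic_binomials :: ((nat \<Rightarrow>\<^sub>0 nat) \<Rightarrow>\<^sub>0 'k::field) set) (defining_ideal e n)"
proof -
  let ?R = "mpoly_ring e :: ((nat \<Rightarrow>\<^sub>0 nat) \<Rightarrow>\<^sub>0 'k) ring"
  let ?G = "quadratic_binomials :: ((nat \<Rightarrow>\<^sub>0 nat) \<Rightarrow>\<^sub>0 'k) set"
  interpret R: cring ?R by (rule cring_mpoly_ring)
  have G: "?G \<subseteq> carrier ?R" using quadratic_binomials_subset defining_ideal_iff by blast
  have "Idl\<^bsub>?R\<^esub> ?G \<subseteq> defining_ideal e n"
    by (rule R.genideal_minimal[OF ideal_defining_ideal quadratic_binomials_subset])
  moreover have "defining_ideal e n \<subseteq> Idl\<^bsub>?R\<^esub> ?G"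
    using R.genideal_ideal[OF G] R.genideal_self[OF G]
    by (intro defining_ideal_subset binomial_in_ideal[OF assms]) auto
  moreover have "Idl\<^bsub>?R\<^esub> H \<noteq> defining_ideal e n" if H: "H \<subset> ?G" for H
  proof
    assume eq: "Idl\<^bsub>?R\<^esub> H = defining_ideal e n"
    obtain i j where ij: "1 \<le> i" "i \<le> j" "j < e" "unit_vec i + unit_vec j \<notin> Bset e n"
      and notin: "fpoly e n (unit_vec j) i \<notin> H"
      using H by (auto simp: quadratic_binomials_def)
    define \<sigma> where "\<sigma> = unit_vec i + unit_vec j"
    define D where "D = {\<alpha>. \<exists>\<beta>. \<sigma> = \<alpha> + \<beta>}"
    define J where "J = {p \<in> carrier ?R. Poly_Mapping.keys p \<inter> D = {}}"
    have "ideal J ?R" unfolding J_def by (rule ideal_lookup_eq_0) (auto simp: D_def add.assoc)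
    have \<sigma>: "\<sigma> \<in> exponents e" using ij by (simp add: \<sigma>_def exponents_add)
    have D: "\<alpha> = 0 \<or> \<alpha> \<in> unit_vec ` {..<e} \<or> \<alpha> = \<sigma>" if \<alpha>: "\<alpha> \<in> D" for \<alpha>
    proof (rule ccontr)
      assume *: "\<not> ?thesis"
      obtain \<beta> where \<beta>: "\<sigma> = \<alpha> + \<beta>" using \<alpha> by (auto simp: D_def)
      with \<sigma> have ex: "\<alpha> \<in> exponents e" "\<beta> \<in> exponents e" using exponents_addD by blast+
      obtain k \<alpha>' where k: "k < e" "\<alpha>' \<in> exponents e" "\<alpha> = unit_vec k + \<alpha>'"
        using nonzero_exponent_eq_unit_vec_add[OF ex(1)] * by blast
      have "\<beta> \<noteq> 0" using * \<beta> by auto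
      then obtain l \<beta>' where l: "l < e" "\<beta> = unit_vec l + \<beta>'"
        using nonzero_exponent_eq_unit_vec_add[OF ex(2)] by blast
      \<comment> \<open>With all weights 1, \<open>wdeg\<close> is the total degree. One unit vector
        split off from each factor already accounts for the total degree 2 of
        \<open>\<sigma>\<close>.\<close>
      interpret total: positive_weights e "\<lambda>_. 1" by unfold_locales (simp_all add: e_pos)
      have "wdeg e (\<lambda>_. 1) \<sigma> = 2" using ij by (simp add: \<sigma>_def)
      then have "wdeg e (\<lambda>_. 1) \<alpha>' = 0" using k l by (simp add: \<beta>)
      then have "\<alpha>' = 0" using total.wdeg_eq_0_imp k(2) by blast
      with * k show False by simp
    qed
    have "H \<subseteq> J"
    proof
      fix h assume "h \<in> H"
      with H have "h \<in> ?G" by blast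
      then obtain i' j' where h: "h = fpoly e n (unit_vec j') i'"
        and ij': "1 \<le> i'" "i' \<le> j'" "j' < e" "unit_vec i' + unit_vec j' \<notin> Bset e n"
        by (auto simp: quadratic_binomials_def)
      define \<sigma>' where "\<sigma>' = unit_vec i' + unit_vec j'"
      define \<tau> where "\<tau> = tau e n (wdeg e n \<sigma>')"
      have \<sigma>': "\<sigma>' \<in> exponents e" using ij' by (simp add: \<sigma>'_def exponents_add)
      have heq: "h = xpow \<sigma>' - xpow \<tau>" by (simp add: h fpoly_eq \<sigma>'_def \<tau>_def)
      have deg: "wdeg e n \<tau> = wdeg e n \<sigma>'" using wdeg_tau[OF \<sigma>'] by (simp add: \<tau>_def)
      have nz: "\<sigma>' \<noteq> 0" "\<sigma>' \<notin> range unit_vec" by (auto simp: \<sigma>'_def add_neq_0)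
      have "\<sigma>' \<noteq> \<sigma>"
        using unit_vec_add_eq_sorted[of i' j' i j] ij(2) ij'(2) notin h \<open>h \<in> H\<close>
        by (auto simp: \<sigma>_def \<sigma>'_def)
      then have "\<sigma>' \<notin> D" using D nz by auto
      \<comment> \<open>The normal form lies in B, while \<open>\<sigma>\<close> does not.\<close>
      have "\<tau> \<noteq> \<sigma>"
        using ij tau_in_Bset[OF \<sigma>'] by (auto simp: \<tau>_def \<sigma>_def)
      moreover have "\<tau> \<noteq> 0" using deg nz(1) wdeg_eq_0_imp[OF \<sigma>'] by auto
      \<comment> \<open>If \<open>\<tau>\<close> were eps_l, then \<open>\<sigma>'\<close> would
        have degree n_l and so equal eps_l by indecomposability.\<close>
      moreover have "\<tau> \<noteq> unit_vec l" if "l < e" for l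
        using deg nz(2) weight_indecomposable[OF \<sigma>' that] that by auto
      ultimately have "\<tau> \<notin> D" using D by blast
      with \<open>\<sigma>' \<notin> D\<close> have "Poly_Mapping.keys h \<inter> D = {}"
        using keys_diff[of "xpow \<sigma>' :: _ \<Rightarrow>\<^sub>0 'k" "xpow \<tau>"] by (auto simp: heq xpow_def)
      moreover have "h \<in> carrier ?R" using G \<open>h \<in> ?G\<close> by blast
      ultimately show "h \<in> J" unfolding J_def by blast
    qed
    then have "defining_ideal e n \<subseteq> J"
      using R.genideal_minimal[OF \<open>ideal J ?R\<close>, of H] eq by blast
    then have "fpoly e n (unit_vec j) i \<in> J"
      using binomial_in_defining_ideal[OF \<sigma>] by (auto simp: fpoly_eq \<sigma>_def)
    moreover have "\<sigma> \<in> D" unfolding D_def by (auto intro: exI[of _ 0])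
    ultimately have "Poly_Mapping.lookup (fpoly e n (unit_vec j) i) \<sigma> = (0::'k)"
      by (auto simp: J_def in_keys_iff)
    \<comment> \<open>The second term does not cancel the first, so the coefficient at
      \<open>\<sigma>\<close> is 1.\<close>
    moreover have "tau e n (wdeg e n \<sigma>) \<noteq> \<sigma>" using ij tau_eq_iff[OF \<sigma>] by (simp add: \<sigma>_def)
    ultimately show False
      by (simp add: fpoly_eq lookup_minus xpow_def lookup_single flip: \<sigma>_def)
  qed
  ultimately show ?thesis using G by (auto simp: minimal_ideal_generating_set_def)
qed

end


section \<open>The arithmetic of the generators\<close>

locale arith_gens =
  fixes e a b d :: nat and n :: "nat \<Rightarrow> nat"
  assumes e: "e \<ge> 5" and a: "a = e + 1" and d_pos: "d > 0"
    and b_gt: "b > a + (e - 3) * d" and coprime: "coprime a d"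
    and minimal: "minimal_semigroup_generating_set (n ` {..<e}) (semigroup_span (n ` {..<e}))"
    and n: "n = gens e a b d"
begin

lemma n_simps [simp]:
  "i \<le> e - 3 \<Longrightarrow> n i = a + i * d" "n (e - 2) = b" "n (e - Suc 0) = b + d" "n 0 = e + 1"
  using e by (auto simp: n gens_def a)

lemma index_cases:
  assumes "i < e"
  obtains "i \<le> e - 3" | "i = e - 2" | "i = e - 1"
  using assms e by linarith

lemma n_strict_mono:
  assumes "i < j" "j < e"
  shows "n i < n j"
proof -
  have lt: "n k < b" if "k \<le> e - 3" for k
  proof -
    have "n k \<le> a + (e - 3) * d" using that by simp
    then show ?thesis using b_gt by (rule le_less_trans)
  qed
  from assms(2) show ?thesis
  proof (cases rule: index_cases)
    case 1
    then show ?thesis using assms d_pos by simp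
  next
    case 2
    then have "i \<le> e - 3" using assms by simp
    then show ?thesis using lt[of i] 2 by simp
  next
    case 3
    have "i < e" using assms by simp
    then show ?thesis
      using lt[of i] d_pos 3 assms(1) by (cases rule: index_cases) auto
  qed
qed

lemma inj_n: "inj_on n {..<e}"
proof (rule inj_onI)
  fix i j assume "i \<in> {..<e}" "j \<in> {..<e}" "n i = n j"
  then show "i = j" using n_strict_mono[of i j] n_strict_mono[of j i] by (cases i j rule: linorder_cases) auto
qed

text \<open>Indecomposability comes from minimality: if entry l of \<open>\<alpha>\<close> were 0,
  then n_l would be spanned by the other generators. So eps_l splits off, and the rest has degree
  0.\<close>

sublocale almost_maximal_weights e n
proof unfold_locales
  show "0 < e" "n 0 = e + 1" using e by simp_all
  have pos: "0 < n i" if "i < e" for i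
    using n_strict_mono[of 0 i] that by (cases "i = 0") auto
  show "\<And>i. i < e \<Longrightarrow> 0 < n i" by (rule pos)
  interpret positive_weights e n by unfold_locales (use e pos in auto)
  fix \<alpha> l assume \<alpha>: "\<alpha> \<in> exponents e" and l: "l < e" and deg: "wdeg e n \<alpha> = n l"
  have "0 < Poly_Mapping.lookup \<alpha> l"
  proof (rule ccontr)
    assume "\<not> 0 < Poly_Mapping.lookup \<alpha> l"
    then have "l \<notin> Poly_Mapping.keys \<alpha>" by (simp add: in_keys_iff)
    \<comment> \<open>By injectivity of \<open>n\<close>, discarding the index l discards the value
      n_l.\<close>
    then have "n ` (Poly_Mapping.keys \<alpha> \<inter> {..<e}) \<subseteq> n ` {..<e} - {n l}"
      using inj_n l by (auto simp: inj_on_def)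
    then have "n l \<in> semigroup_span (n ` {..<e} - {n l})"
      using wdeg_in_span[of e n \<alpha>] deg semigroup_span_subset semigroup_span_base by (metis subset_iff)
    then show False
      using minimal_semigroup_generating_set_not_in_span[OF minimal] l by blast
  qed
  then obtain \<beta> where \<beta>: "\<alpha> = unit_vec l + \<beta>" by (rule exponents_eq_unit_vec_add)
  then have "wdeg e n \<beta> = 0" "\<beta> \<in> exponents e"
    using deg l \<alpha> exponents_addD(2) by auto
  then have "\<beta> = 0" by (rule wdeg_eq_0_imp[rotated])
  with \<beta> show "\<alpha> = unit_vec l" by simp
qed

text \<open>The two unit vectors are distinct elements of B with entry 0 equal to 0.\<close>

lemma not_cong_n:
  assumes "1 \<le> i" "i < e" "1 \<le> j" "j < e" "i \<noteq> j"
  shows "\<not> [n i = n j] (mod a)"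
  using Bset_cong_imp_eq[of "unit_vec i" "unit_vec j"] unit_vec_in_Bset assms a
  by (auto simp: lookup_unit_vec)

lemma not_cong_n_0:
  assumes "1 \<le> i" "i < e"
  shows "\<not> [n i = 0] (mod a)"
  using Bset_cong_imp_eq[of "unit_vec i" 0] unit_vec_in_Bset zero_in_Bset assms a
  by (auto simp: lookup_unit_vec)

text \<open>The residues of the generators modulo \<open>a\<close>, divided by \<open>d\<close>, are \<open>0, \<dots>, e - 3, c, c + 1\<close>;
  as they are distinct, \<open>c\<close> is \<open>e - 2\<close> or \<open>e - 1\<close>.\<close>

lemma residue_b:
  obtains c where "[b = c * d] (mod a)" "c = e - 2 \<or> c = e - 1"
proof -
  \<comment> \<open>u inverts d modulo a, so c represents b divided by d.\<close>
  obtain u where u: "[d * u = 1] (mod a)"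
    using cong_solve_coprime_nat[of d a] coprime by (auto simp: coprime_commute)
  define c where "c = (u * b) mod a"
  have "[c * d = u * b * d] (mod a)"
    unfolding c_def by (intro cong_mult cong_refl) (simp add: cong_def)
  moreover have "[u * b * d = b] (mod a)"
    using cong_mult[OF u cong_refl[of b]] by (simp add: ac_simps)
  ultimately have bc: "[b = c * d] (mod a)" using cong_sym cong_trans by blast
  have "c < a" using a by (simp add: c_def)
  \<comment> \<open>For such c, b would share the residue of n_c. Below, c = 0 and c = e would make
    b and b + d, respectively, divisible by a.\<close>
  moreover have False if c: "1 \<le> c" "c \<le> e - 3"
  proof -
    have "[n (e - 2) = n c] (mod a)" using bc c by (simp add: cong_def)
    with not_cong_n[of "e - 2" c] c e show False by simp
  qed
  moreover have "c \<noteq> 0"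
  proof
    assume "c = 0"
    then have "[n (e - 2) = 0] (mod a)" using bc by simp
    with not_cong_n_0[of "e - 2"] e show False by simp
  qed
  moreover have "c \<noteq> e"
  proof
    assume "c = e"
    have "[b + d = e * d + d] (mod a)" using bc \<open>c = e\<close> by (intro cong_add cong_refl) simp
    moreover have "e * d + d = a * d" by (simp add: a)
    ultimately have "[n (e - 1) = 0] (mod a)" by (simp add: cong_def)
    with not_cong_n_0[of "e - 1"] e show False by simp
  qed
  ultimately have "c = e - 2 \<or> c = e - 1" using a e by fastforce
  with bc show ?thesis by (rule that)
qed

section \<open>Doubled unit vectors lie outside B\<close>

lemma double_not_in_Bset_arith:
  assumes "1 \<le> p" "p < e - 3"
  shows "unit_vec p + unit_vec p \<notin> Bset e n"
proof
  assume "unit_vec p + unit_vec p \<in> Bset e n"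
  \<comment> \<open>Both neighbours of p still lie in the arithmetic progression, and their sum is
    lexicographically larger at entry p - 1.\<close>
  moreover have "n (p - 1) + n (p + 1) = n p + n p"
    using assms by (cases p) (simp_all add: algebra_simps)
  ultimately have "unit_vec (p - 1) + unit_vec (p + 1) \<le> unit_vec p + unit_vec p"
    using assms by (intro le_BsetI) (auto simp: exponents_add)
  moreover have "unit_vec p + unit_vec p < unit_vec (p - 1) + unit_vec (p + 1)"
    unfolding less_exponent_iff_lex using assms
    by (intro exI[of _ "p - 1"]) (auto simp: lookup_add lookup_unit_vec)
  ultimately show False by simp
qed

text \<open>The multiples j d are residues of 0 and of the generators. If 2 n_p had such a residue,
  2 eps_p would be congruent in degree to a different Apery element.\<close>

lemma double_in_Bset_not_cong:
  assumes p: "unit_vec p + unit_vec p \<in> Bset e n" "1 \<le> p" "p < e"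
    and bc: "[b = c * d] (mod a)"
    and j: "j \<le> e - 3 \<or> j = c \<or> j = c + 1"
    and eq: "[n p = q * d] (mod a)"
  shows "2 * q \<noteq> k * a + j"
proof
  assume q: "2 * q = k * a + j"
  have "[n p + n p = q * d + q * d] (mod a)" using eq by (intro cong_add)
  moreover have "q * d + q * d = k * d * a + j * d"
    using arg_cong[OF q, of "\<lambda>x. x * d"] by (simp add: algebra_simps)
  ultimately have pj: "[wdeg e n (unit_vec p + unit_vec p) = j * d] (mod a)"
    using p(3) by (simp add: cong_def)
  have n0: "n 0 = a" using a by simp
  \<comment> \<open>The witness is 0 for j = 0, and otherwise eps_j, eps_{e-2} or eps_{e-1}
    according to the three options for j.\<close>
  have "\<exists>\<beta>. \<beta> \<in> Bset e n \<and> Poly_Mapping.lookup \<beta> 0 = 0 \<and> [wdeg e n \<beta> = j * d] (mod a) \<and>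
      unit_vec p + unit_vec p \<noteq> \<beta>"
  proof (cases "j = 0")
    case True
    then show ?thesis by (intro exI[of _ 0]) (simp add: zero_in_Bset add_neq_0)
  next
    case False
    have "\<exists>l. 1 \<le> l \<and> l < e \<and> [n l = j * d] (mod a)"
      using j
    proof (elim disjE)
      assume "j \<le> e - 3"
      then show ?thesis using e False by (intro exI[of _ j]) (auto simp: cong_def)
    next
      assume "j = c"
      then show ?thesis using e bc by (intro exI[of _ "e - 2"]) auto
    next
      assume "j = c + 1"
      then show ?thesis
        using e cong_add[OF bc cong_refl[of d]] by (intro exI[of _ "e - 1"]) (auto simp: add.commute)
    qed
    then obtain l where "1 \<le> l" "l < e" "[n l = j * d] (mod a)" by blast
    then show ?thesis
      by (intro exI[of _ "unit_vec l"]) (auto simp: unit_vec_in_Bset lookup_unit_vec)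
  qed
  then obtain \<beta> where \<beta>: "\<beta> \<in> Bset e n" "Poly_Mapping.lookup \<beta> 0 = 0" "[wdeg e n \<beta> = j * d] (mod a)"
    "unit_vec p + unit_vec p \<noteq> \<beta>" by blast
  have "[wdeg e n (unit_vec p + unit_vec p) = wdeg e n \<beta>] (mod n 0)"
    using cong_trans[OF pj cong_sym[OF \<beta>(3)]] n0 by simp
  with Bset_cong_imp_eq[OF p(1) _ \<beta>(1,2)] p(2) \<beta>(4) show False
    by (simp add: lookup_add lookup_unit_vec)
qed

text \<open>The one case with \<open>p \<ge> e - 3\<close> in which the residue of \<open>2 n\<^sub>p\<close> is that of the extra element
  of the Apery set: there \<open>2 n\<^sub>3\<close> competes with \<open>n\<^sub>1 + n\<^sub>5\<close>, and loses because \<open>b\<close> would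
  otherwise be decomposable.\<close>

lemma double_not_in_Bset_special:
  assumes "e = 6" "[b = 4 * d] (mod a)"
  shows "unit_vec 3 + unit_vec 3 \<notin> Bset e n"
proof
  assume B: "unit_vec 3 + unit_vec 3 \<in> Bset e n"
  have ns: "n 0 = 7" "n (Suc 0) = 7 + d" "n 3 = 7 + 3 * d" "n 4 = b" "n 5 = b + d"
    using n_simps assms(1) a by (auto simp: eval_nat_numeral)
  have "[n 1 + n 5 = n 3 + n 3] (mod 7)"
  proof -
    have "n 1 + n 5 = b + (7 + 2 * d)" by (simp add: ns)
    also have "[b + (7 + 2 * d) = 4 * d + (7 + 2 * d)] (mod 7)"
      using assms a by (intro cong_add cong_refl) simp
    also have "4 * d + (7 + 2 * d) = 7 + 6 * d" by simp
    also have "[7 + 6 * d = 14 + 6 * d] (mod 7)"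
      by (intro cong_add cong_refl) (simp add: cong_def)
    also have "14 + 6 * d = n 3 + n 3" by (simp add: ns)
    finally show ?thesis .
  qed
  show False
  proof (cases "n 1 + n 5 \<le> n 3 + n 3")
    case True
    then obtain k where k: "n 3 + n 3 = k * 7 + (n 1 + n 5)"
      using \<open>[n 1 + n 5 = n 3 + n 3] (mod 7)\<close> cong_le_nat cong_sym by blast
    \<comment> \<open>k copies of eps_0 make up the difference of degrees. The vector is larger at
      entry 0 if k > 0, and at entry 1 if k = 0.\<close>
    let ?\<beta> = "Poly_Mapping.single 0 k + (unit_vec 1 + unit_vec 5)"
    have "?\<beta> \<le> unit_vec 3 + unit_vec 3"
      using k assms(1) ns(1)
      by (intro le_BsetI[OF B] exponents_add) (auto simp: wdeg_single exponents_def unit_vec_def)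
    moreover have "unit_vec 3 + unit_vec 3 < ?\<beta>"
    proof (cases "k = 0")
      case True
      then show ?thesis unfolding less_exponent_iff_lex
        by (intro exI[of _ 1]) (auto simp: lookup_add lookup_unit_vec)
    next
      case False
      then show ?thesis unfolding less_exponent_iff_lex
        by (intro exI[of _ 0]) (auto simp: lookup_add lookup_unit_vec)
    qed
    ultimately show False by simp
  next
    case False
    then obtain k where k: "n 1 + n 5 = k * 7 + (n 3 + n 3)"
      using \<open>[n 1 + n 5 = n 3 + n 3] (mod 7)\<close> cong_le_nat[of "n 3 + n 3" "n 1 + n 5" 7] by auto
    \<comment> \<open>Here k is positive, and solving for b gives b = 7 (k - 1) + n_1 + n_3, a
      second factorization of n_4.\<close>
    with False obtain m where "k = Suc m" by (cases k) auto
    with k have "n 4 = m * n 0 + (n 1 + n 3)" using assms(1) by (simp add: ns)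
    then have "Poly_Mapping.single 0 m + (unit_vec 1 + unit_vec 3) = unit_vec 4"
      using assms(1) by (intro weight_indecomposable exponents_add)
        (auto simp: wdeg_single exponents_def unit_vec_def)
    then have "Poly_Mapping.lookup (Poly_Mapping.single 0 m + (unit_vec 1 + unit_vec 3)) 1 = Poly_Mapping.lookup (unit_vec 4) 1"
      by simp
    then show False by (simp add: lookup_add lookup_unit_vec)
  qed
qed

text \<open>For p \<ge> e - 3, n_p is congruent to q d with q = e - 3, c or c + 1. Except for e = 6,
  c = 4, p = 3, the number 2 q reduces modulo a to one of 0, ..., e - 3, c, c + 1, which
  \<open>not_cong\<close> excludes.\<close>

lemma double_not_in_Bset:
  assumes "1 \<le> p" "p < e"
  shows "unit_vec p + unit_vec p \<notin> Bset e n"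
proof
  assume B: "unit_vec p + unit_vec p \<in> Bset e n"
  obtain c where bc: "[b = c * d] (mod a)" and c: "c = e - 2 \<or> c = e - 1" by (rule residue_b)
  have not_cong: "2 * q \<noteq> k * a + j"
    if "j \<le> e - 3 \<or> j = c \<or> j = c + 1" "[n p = q * d] (mod a)" for q j k
    using double_in_Bset_not_cong[OF B assms bc that] .
  have "\<not> p < e - 3" using double_not_in_Bset_arith[of p] assms B by blast
  then consider "p = e - 3" | "p = e - 2" | "p = e - 1" using assms by linarith
  then show False
  proof cases
    case 1
    then have q: "[n p = (e - 3) * d] (mod a)" by (simp add: cong_def)
    show False
    proof (cases "e = 6 \<and> c = 4")
      case True
      with double_not_in_Bset_special bc B 1 show False by simp
    next
      case False
      then consider "e = 5" | "e = 6" "c = 5" | "e \<ge> 7" using e c by fastforce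
      then show False
      proof cases
        case 1
        \<comment> \<open>Here c is 3 or 4, so 2 q = 4 is c + 1 or c.\<close>
        then show False using not_cong[of 4 "e - 3" 0] q c by auto
      next
        case 2
        \<comment> \<open>Here 2 q = 6 = c + 1.\<close>
        then show False using not_cong[of 6 "e - 3" 0] q by auto
      next
        case 3
        then have "2 * (e - 3) = 1 * a + (e - 7)" "e - 7 \<le> e - 3" using a by simp_all
        then show False using not_cong[of "e - 7" "e - 3" 1] q by blast
      qed
    qed
  next
    case 2
    then have q: "[n p = c * d] (mod a)" using bc by simp
    from c have "2 * c = 1 * a + (e - 5) \<or> 2 * c = 1 * a + (e - 3)" using e a by auto
    moreover have "e - 5 \<le> e - 3" by simp
    ultimately show False using not_cong[OF _ q] by blast
  next
    case 3
    then have q: "[n p = (c + 1) * d] (mod a)"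
      using cong_add[OF bc cong_refl[of d]] by (simp add: add.commute)
    \<comment> \<open>The first equation belongs to c = e - 2, the second to c = e - 1.\<close>
    from c have "2 * (c + 1) = 1 * a + (e - 3) \<or> 2 * (c + 1) = 1 * a + c" using e a by auto
    then show False using not_cong[OF _ q] by blast
  qed
qed

end

theorem lemma5p11:
  fixes e a b d :: nat and n :: "nat \<Rightarrow> nat" and M :: "nat set"
    and G :: "((nat \<Rightarrow>\<^sub>0 nat) \<Rightarrow>\<^sub>0 'k::field) set"
  assumes "e \<ge> 5" and "a = e + 1" and "b > 0" and "d > 0"
    and "b > a + (e - 3) * d" and "coprime a d" and "\<not> d dvd (b - a)"
    and M: "M = {a + i * d | i. i \<le> e - 3} \<union> {b, b + d}"
    and "minimal_semigroup_generating_set M (semigroup_span M)"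
    and n: "n = gens e a b d"
    and G: "G = (\<Union>i\<in>{1..e - 1}.
        {fpoly e n (unit_vec j) i | j. unit_vec j \<in> Bset_i' e n i \<and> i \<le> j \<and> j \<le> e - 1})"
  shows "minimal_ideal_generating_set (mpoly_ring e) G (defining_ideal e n)"
proof -
  interpret arith_gens e a b d n
    using assms gens_image[of e a b d] by unfold_locales auto
  \<comment> \<open>Identifies \<open>G\<close> with the quadratic binomials of the abstract
    setting, whose hypothesis on doubles is now available.\<close>
  have iff: "i \<in> {1..e - 1} \<and> unit_vec j \<in> Bset_i' e n i \<and> i \<le> j \<and> j \<le> e - 1 \<longleftrightarrow>
      1 \<le> i \<and> i \<le> j \<and> j < e \<and> unit_vec i + unit_vec j \<notin> Bset e n" for i j
    using unit_vec_in_Bset_i'_iff[of i j] e_pos by (cases "j < e") auto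
  have "G = {fpoly e n (unit_vec j) i | i j.
      i \<in> {1..e - 1} \<and> unit_vec j \<in> Bset_i' e n i \<and> i \<le> j \<and> j \<le> e - 1}"
    unfolding G by blast
  then have "G = quadratic_binomials" unfolding iff quadratic_binomials_def .
  then show ?thesis using quadratic_binomials_minimal[OF double_not_in_Bset] by simp
qed

end
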